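(* Let $\rho>0$ and let $f:B_{\rho}\to H$ be a $C^1$ function with Lipschitzian derivative. Then, the following assertions are equivalent: (i) for each $r>0$ small enough, there exists a unique $x^*\in S_r$ such that $$\|f(x^* )-x^*\|=\mathrm{dist}(f(x^* ),B_r)$$ and $$\|f(x)-x^*\|<\|f(x)-x\|$$ for all $x\in B_r\setminus\{x^*\}$; (ii) $f(0)\neq 0$.
   Context: $(H,\langle\cdot,\cdot\rangle)$ is a real Hilbert space. For each $r>0$, $B_r=\{x\in H:\|x\|\leq r\}$ and $S_r=\{x\in H:\|x\|=r\}$. The derivative of $f$ is the Fréchet derivative, with values in the space $\mathcal{L}(H)$ of bounded linear operators on $H$ with the operator norm. For $z\in H$ and non-empty $T\subseteq H$, $\mathrm{dist}(z,T)=\inf_{y\in T}\|z-y\|$. "For each $r>0$ small enough" means: there is $r^*\in\,]0,\rho]$ such that the property holds for every $r\in\,]0,r^*]$. *)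

theory Defs
  imports "HOL-Analysis.Analysis"
begin

text \<open>The derivative takes values in the space of bounded linear operators with the operator norm.
  Differentiability is taken within \<open>S\<close>; on a closed ball this gives the usual Frechet derivative at
  interior points, and at boundary points the (still unique) derivative relative to the ball.\<close>

definition C1_on_with_deriv ::
  "'a::real_normed_vector set \<Rightarrow> ('a \<Rightarrow> 'b::real_normed_vector) \<Rightarrow> ('a \<Rightarrow> 'a \<Rightarrow>\<^sub>L 'b) \<Rightarrow> bool"
  where "C1_on_with_deriv S f f' \<longleftrightarrow>
    (\<forall>x\<in>S. (f has_derivative blinfun_apply (f' x)) (at x within S)) \<and> continuous_on S f'"

end

theory Submission
  imports Defs
begin

text \<open>The derivative is bounded on the ball, so $f$ has a Lipschitz constant $M$ there
  (\<open>C1_on_with_deriv_imp_lipschitz\<close>). Squaring, the inequality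
  $\|f(x)-x^*\| < \|f(x)-x\|$ with $\|x^*\| = r$ says
  $2\langle f(x), x^*-x\rangle > r^2-\|x\|^2$. Suppose that $f(x^*) = \lambda x^*$ with
  $\lambda > 2M+1$. The identity $2\langle x^*, x^*-x\rangle = \|x^*-x\|^2 + r^2 - \|x\|^2$ turns the main part
  $2\langle f(x^*), x^*-x\rangle$ into $\lambda(\|x^*-x\|^2 + r^2 - \|x\|^2)$, while replacing
  $f(x^*)$ by $f(x)$ costs at most $2M\|x^*-x\|^2$, so the inequality holds for all
  $x \neq x^*$ in $B_r$ (\<open>dist_eigenpoint_less\<close>). Moreover $x^*$ is then the point of $B_r$
  nearest to $f(x^*)$ (\<open>infdist_scaleR_cball\<close>).

  Such an $x^*$ is a fixed point of $x \mapsto r f(x)/\|f(x)\|$. If $f(0) \neq 0$ this map is a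
  contraction of $B_r$ for small $r$, because $\|f\|$ is bounded below near $0$
  (\<open>ex_radial_fixed_point\<close>), and the eigenvalue $\lambda = \|f(x^*)\|/r$ is as large as needed.
  Uniqueness needs no smallness: if $x^*$ and $y^*$ both qualify and differ, then
  $\|f(y^*)-x^*\| < \|f(y^*)-y^*\| = \mathrm{dist}(f(y^*), B_r) \le \|f(y^*)-x^*\|$. Conversely,
  if $f(0) = 0$, the inequality at $x = 0$ reads $r < 0$.\<close>

lemma norm_sgn_diff_le:
  fixes u v :: "'a::real_normed_vector"
  assumes "u \<noteq> 0" "v \<noteq> 0"
  shows "norm (sgn u - sgn v) \<le> 2 * norm (u - v) / norm u"
proof -
  have "sgn u - sgn v = (u - v) /\<^sub>R norm u + (inverse (norm u) - inverse (norm v)) *\<^sub>R v"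
    by (simp add: sgn_div_norm algebra_simps)
  also have "norm \<dots> \<le> norm (u - v) / norm u + \<bar>inverse (norm u) - inverse (norm v)\<bar> * norm v"
    by (rule norm_triangle_le) (simp add: divide_inverse mult.commute)
  also have "\<bar>inverse (norm u) - inverse (norm v)\<bar> * norm v = \<bar>norm v - norm u\<bar> / norm u"
  proof -
    have "inverse (norm u) - inverse (norm v) = (norm v - norm u) / (norm u * norm v)"
      using assms by (simp add: field_simps)
    then show ?thesis using assms by (simp add: abs_mult)
  qed
  also have "\<bar>norm v - norm u\<bar> \<le> norm (u - v)"
    by (metis norm_minus_commute norm_triangle_ineq3)
  finally show ?thesis by (simp add: divide_right_mono add_divide_distrib)
qed

text \<open>The point is a fixed point of \<open>x \<mapsto> r *\<^sub>R sgn (f x)\<close>, which maps the ball into itself and is a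
  contraction with constant \<open>2 * r * M / m\<close>.\<close>

lemma ex_radial_fixed_point:
  fixes f :: "'a::{real_normed_vector, complete_space} \<Rightarrow> 'a"
  assumes lip: "M-lipschitz_on (cball 0 r) f"
    and lower: "\<And>x. x \<in> cball 0 r \<Longrightarrow> m \<le> norm (f x)"
    and r: "0 < r" and m: "0 < m" "2 * r * M < m"
  shows "\<exists>x. norm x = r \<and> f x = (norm (f x) / r) *\<^sub>R x"
proof -
  define g where "g x = r *\<^sub>R sgn (f x)" for x
  have nz: "f x \<noteq> 0" if "x \<in> cball 0 r" for x
    using lower[OF that] m by auto
  have norm_g: "norm (g x) = r" if "x \<in> cball 0 r" for x
    using nz[OF that] r by (simp add: g_def norm_sgn)
  have M: "0 \<le> M" using lip by (rule lipschitz_on_nonneg)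
  have contraction: "dist (g x) (g y) \<le> (2 * r * M / m) * dist x y"
    if x: "x \<in> cball 0 r" and y: "y \<in> cball 0 r" for x y
  proof -
    have "dist (g x) (g y) = r * norm (sgn (f x) - sgn (f y))"
      using r by (simp add: g_def dist_norm flip: scaleR_diff_right)
    also have "\<dots> \<le> r * (2 * norm (f x - f y) / norm (f x))"
      using r norm_sgn_diff_le[OF nz[OF x] nz[OF y]] by (intro mult_left_mono) auto
    also have "\<dots> \<le> r * (2 * (M * dist x y) / m)"
      using r m M lower[OF x] lipschitz_onD[OF lip x y]
      by (intro mult_left_mono frac_le) (auto simp: dist_norm)
    finally show ?thesis by (simp add: mult_ac)
  qed
  have "\<exists>!x\<in>cball 0 r. g x = x"
  proof (rule Banach_fix)
    show "complete (cball (0::'a) r)" by (simp add: complete_eq_closed)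
    show "cball (0::'a) r \<noteq> {}" using r by simp
    show "0 \<le> 2 * r * M / m" "2 * r * M / m < 1" using r m M by auto
    show "g ` cball 0 r \<subseteq> cball 0 r" using norm_g by auto
  qed (use contraction in auto)
  then obtain x where x: "x \<in> cball 0 r" "g x = x" by blast
  have "(norm (f x) / r) *\<^sub>R x = (norm (f x) / r) *\<^sub>R g x" using x by simp
  also have "\<dots> = f x" using r nz[OF x(1)] by (simp add: g_def sgn_div_norm)
  finally show ?thesis using norm_g[OF x(1)] x(2) by (intro exI[of _ x]) simp
qed

lemma dist_eigenpoint_less:
  fixes f :: "'a::real_inner \<Rightarrow> 'a"
  assumes lip: "M-lipschitz_on (cball 0 r) f"
    and z: "norm z = r" "f z = c *\<^sub>R z" and c: "2 * M + 1 < c"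
    and x: "x \<in> cball 0 r" "x \<noteq> z"
  shows "norm (f x - z) < norm (f x - x)"
proof -
  define d where "d = (norm (z - x))\<^sup>2"
  define e where "e = r\<^sup>2 - (norm x)\<^sup>2"
  have d: "0 < d" using x by (simp add: d_def)
  have e: "0 \<le> e" using x by (simp add: e_def power_mono)
  have M: "0 \<le> M" using lip by (rule lipschitz_on_nonneg)
  have "2 * inner z (z - x) = d + e"
    unfolding d_def e_def z(1)[symmetric]
    by (simp add: power2_norm_eq_inner inner_diff inner_commute algebra_simps)
  then have main: "2 * inner (f z) (z - x) = c * (d + e)"
    by (simp add: z(2))
  have "\<bar>inner (f x - f z) (z - x)\<bar> \<le> norm (f x - f z) * norm (z - x)"
    by (rule Cauchy_Schwarz_ineq2)
  also have "\<dots> \<le> (M * norm (z - x)) * norm (z - x)"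
    using lipschitz_onD[OF lip x(1), of z] z(1)
    by (intro mult_right_mono) (auto simp: dist_norm norm_minus_commute)
  finally have error: "\<bar>inner (f x - f z) (z - x)\<bar> \<le> M * d"
    by (simp add: d_def power2_eq_square mult_ac)
  have "e \<le> c * e" using M c e by (simp add: mult_le_cancel_right1)
  moreover have "2 * M * d < c * d" using M c d by (intro mult_strict_right_mono) auto
  ultimately have "e + 2 * M * d < c * (d + e)" by (simp add: distrib_left)
  then have "e < 2 * inner (f x) (z - x)"
    using main error by (simp add: inner_diff_left)
  then have "(norm (f x - z))\<^sup>2 < (norm (f x - x))\<^sup>2"
    unfolding e_def z(1)[symmetric]
    by (simp add: power2_norm_eq_inner inner_diff inner_commute algebra_simps)
  then show ?thesis by (rule power_less_imp_less_base) simp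
qed

lemma infdist_scaleR_cball:
  fixes z :: "'a::real_normed_vector"
  assumes "1 \<le> c"
  shows "infdist (c *\<^sub>R z) (cball 0 (norm z)) = norm (c *\<^sub>R z - z)"
proof (rule antisym)
  show "infdist (c *\<^sub>R z) (cball 0 (norm z)) \<le> norm (c *\<^sub>R z - z)"
    by (metis dist_norm infdist_le mem_cball_0 order_refl)
  have "norm (c *\<^sub>R z - z) = norm ((c - 1) *\<^sub>R z)"
    by (simp add: scaleR_left_diff_distrib)
  also have "\<dots> = norm (c *\<^sub>R z) - norm z"
    using assms by (simp add: left_diff_distrib)
  finally have "norm (c *\<^sub>R z - z) \<le> dist (c *\<^sub>R z) y" if "y \<in> cball 0 (norm z)" for y
    using that norm_triangle_ineq2[of "c *\<^sub>R z" y] by (simp add: dist_norm)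
  then show "norm (c *\<^sub>R z - z) \<le> infdist (c *\<^sub>R z) (cball 0 (norm z))"
    by (subst infdist_notempty) (auto intro!: cINF_greatest)
qed

lemma C1_on_with_deriv_imp_lipschitz:
  fixes f :: "'a::real_normed_vector \<Rightarrow> 'b::real_normed_vector"
  assumes C1: "C1_on_with_deriv (cball a \<rho>) f f'" and lip: "L-lipschitz_on (cball a \<rho>) f'"
    and \<rho>: "0 \<le> \<rho>"
  shows "(norm (f' a) + L * \<rho>)-lipschitz_on (cball a \<rho>) f"
proof (rule lipschitz_onI)
  have L: "0 \<le> L" using lip by (rule lipschitz_on_nonneg)
  then show "0 \<le> norm (f' a) + L * \<rho>" using \<rho> by simp
  have bound: "onorm (f' x) \<le> norm (f' a) + L * \<rho>" if x: "x \<in> cball a \<rho>" for x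
  proof -
    have "norm (f' x) \<le> norm (f' a) + dist (f' x) (f' a)"
      using norm_triangle_sub[of "f' x" "f' a"] by (simp add: dist_norm)
    also have "dist (f' x) (f' a) \<le> L * dist x a"
      using lip x \<rho> by (intro lipschitz_onD) auto
    also have "\<dots> \<le> L * \<rho>"
      using L x by (intro mult_left_mono) (auto simp: dist_commute)
    finally show ?thesis by (simp add: norm_blinfun.rep_eq)
  qed
  show "dist (f x) (f y) \<le> (norm (f' a) + L * \<rho>) * dist x y"
    if "x \<in> cball a \<rho>" "y \<in> cball a \<rho>" for x y
    unfolding dist_norm
    by (rule differentiable_bound[where S = "cball a \<rho>" and f' = "\<lambda>x. f' x"])
      (use C1 bound that in \<open>auto simp: C1_on_with_deriv_def\<close>)
qed

theorem theorem7:
  fixes f :: "'a::{real_inner, complete_space} \<Rightarrow> 'a"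
    and f' :: "'a \<Rightarrow> 'a \<Rightarrow>\<^sub>L 'a"
    and \<rho> :: real
  assumes "\<rho> > 0"
    and "C1_on_with_deriv (cball 0 \<rho>) f f'"
    and "\<exists>L. L-lipschitz_on (cball 0 \<rho>) f'"
  shows "(\<exists>r0. 0 < r0 \<and> r0 \<le> \<rho> \<and>
            (\<forall>r. 0 < r \<and> r \<le> r0 \<longrightarrow>
              (\<exists>!xs. xs \<in> sphere 0 r \<and>
                norm (f xs - xs) = infdist (f xs) (cball 0 r) \<and>
                (\<forall>x \<in> cball 0 r - {xs}. norm (f x - xs) < norm (f x - x)))))
         \<longleftrightarrow> f 0 \<noteq> 0"
    (is "(\<exists>r0. 0 < r0 \<and> r0 \<le> \<rho> \<and> (\<forall>r. 0 < r \<and> r \<le> r0 \<longrightarrow> (\<exists>!xs. ?P r xs))) \<longleftrightarrow> _")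
proof
  assume "\<exists>r0. 0 < r0 \<and> r0 \<le> \<rho> \<and> (\<forall>r. 0 < r \<and> r \<le> r0 \<longrightarrow> (\<exists>!xs. ?P r xs))"
  then obtain r xs where r: "0 < r" and xs: "?P r xs"
    by (meson order_refl)
  then have "0 \<in> cball 0 r - {xs}" by auto
  then have "norm (f 0 - xs) < norm (f 0 - 0)" using xs by blast
  then show "f 0 \<noteq> 0" by auto
next
  assume "f 0 \<noteq> 0"
  obtain M where lip_\<rho>: "M-lipschitz_on (cball 0 \<rho>) f"
    using assms C1_on_with_deriv_imp_lipschitz by (metis less_imp_le)
  then have M: "0 \<le> M" by (rule lipschitz_on_nonneg)
  define a where "a = norm (f 0)"
  have a: "0 < a" using \<open>f 0 \<noteq> 0\<close> by (simp add: a_def)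
  \<comment> \<open>For \<open>r \<le> r0\<close> this gives \<open>norm (f x) \<ge> a - M * r \<ge> 3 * (M + 1) * r\<close> on the ball, which covers
    both the contraction condition and \<open>2 * M + 1 < norm (f x) / r\<close>.\<close>
  define r0 where "r0 = min \<rho> (a / (4 * (M + 1)))"
  have "\<exists>!xs. ?P r xs" if r: "0 < r" "r \<le> r0" for r
  proof -
    have "r \<le> a / (4 * (M + 1))" and r_\<rho>: "r \<le> \<rho>" using r by (auto simp: r0_def)
    then have small: "4 * (M * r + r) \<le> a"
      using M by (simp add: pos_le_divide_eq algebra_simps)
    have lip: "M-lipschitz_on (cball 0 r) f"
      using lip_\<rho> r_\<rho> by (auto intro: lipschitz_on_subset)
    have lower: "3 * (M + 1) * r \<le> norm (f x)" if x: "x \<in> cball 0 r" for x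
    proof -
      have "norm (f x - f 0) \<le> M * norm x"
        using lipschitz_onD[OF lip x, of 0] r by (simp add: dist_norm)
      also have "\<dots> \<le> M * r" using x M by (intro mult_left_mono) auto
      finally have "a - M * r \<le> norm (f x)"
        unfolding a_def using norm_triangle_ineq2[of "f 0" "f x"] by (simp add: norm_minus_commute)
      then show ?thesis using small r by (simp add: algebra_simps)
    qed
    obtain z where z: "norm z = r" "f z = (norm (f z) / r) *\<^sub>R z"
    proof (rule exE[OF ex_radial_fixed_point[OF lip lower]])
      show "0 < 3 * (M + 1) * r" using M r by simp
      have "0 \<le> M * r" using M r by simp
      then show "2 * r * M < 3 * (M + 1) * r" using r by (simp add: algebra_simps)
    qed (use r in auto)
    define c where "c = norm (f z) / r"
    have fz: "f z = c *\<^sub>R z" using z by (simp add: c_def)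
    have "3 * (M + 1) \<le> c" using lower[of z] z r by (simp add: c_def pos_le_divide_eq)
    then have c: "2 * M + 1 < c" "1 \<le> c" using M by auto
    show ?thesis
    proof (rule ex1I[of _ z])
      show "?P r z"
        using z(1) fz infdist_scaleR_cball[OF c(2), of z] dist_eigenpoint_less[OF lip z(1) fz c(1)]
        by auto
    next
      fix y assume y: "?P r y"
      show "y = z"
      proof (rule ccontr)
        assume "y \<noteq> z"
        then have "norm (f z - y) < norm (f z - z)" using y z(1) by auto
        also have "\<dots> = infdist (f z) (cball 0 r)"
          using z(1) fz infdist_scaleR_cball[OF c(2), of z] by simp
        also have "\<dots> \<le> norm (f z - y)"
          using y infdist_le[of y "cball 0 r" "f z"] by (auto simp: dist_norm)
        finally show False by simp
      qed
    qed
  qed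
  moreover have "0 < r0" "r0 \<le> \<rho>" using assms(1) a M by (auto simp: r0_def)
  ultimately show "\<exists>r0. 0 < r0 \<and> r0 \<le> \<rho> \<and> (\<forall>r. 0 < r \<and> r \<le> r0 \<longrightarrow> (\<exists>!xs. ?P r xs))"
    by (intro exI[of _ r0]) simp
qed

end
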